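(* Let $p$ be a prime, let $S=\{(a_i,b_i)\}\subset\mathbb{F}_p^2$ be a set of $n<p$ points, and let $\alpha\in\mathbb{F}_p^*$. Define the weighted sumset \[ \Delta_\alpha=\{\alpha a_i+b_i : (a_i,b_i)\in S\} \] and the ratio set \[ Q=\left\{\frac{a_i-a_j}{b_i-b_j} : (a_i,b_i),(a_j,b_j)\in S,\ b_i\neq b_j\right\}. \] Suppose $S$ is not collinear in the sense that there are no $m,\beta\in\mathbb{F}_p$ with $ma_i+\beta-b_i\equiv 0\pmod p$ for all $(a_i,b_i)\in S$. Then \[ |Q|\geq |S|-|\Delta_\alpha|+1. \]
   Context: $\mathbb{F}_p$ is the field with $p$ elements and $\mathbb{F}_p^*=\mathbb{F}_p\setminus\{0\}$; all arithmetic is in $\mathbb{F}_p$. *)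

theory Defs
  imports
    "HOL-Library.Cardinality"
    "HOL-Computational_Algebra.Computational_Algebra"
begin

definition weighted_sumset :: "'a::field \<Rightarrow> ('a \<times> 'a) set \<Rightarrow> 'a set" where
  "weighted_sumset \<alpha> S = {\<alpha> * a + b | a b. (a, b) \<in> S}"

definition ratio_set :: "('a::field \<times> 'a) set \<Rightarrow> 'a set" where
  "ratio_set S = {(a - c) / (b - d) | a b c d. (a, b) \<in> S \<and> (c, d) \<in> S \<and> b \<noteq> d}"

(* Only lines that are graphs b = m * a + \<beta> count here: two or more points on a
   vertical line a = const are not collinear in this sense. *)
definition collinear_pts :: "('a::field \<times> 'a) set \<Rightarrow> bool" where
  "collinear_pts S \<longleftrightarrow> (\<exists>m \<beta>. \<forall>(a, b) \<in> S. m * a + \<beta> - b = 0)"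

end

theory Submission
  imports Defs
begin

text \<open>
  Put \<open>R\<^sub>y(X) = \<Prod>(X - (a - y b))\<close>, the product over \<open>(a, b) \<in> S\<close>, and \<open>h\<^sub>y = X\<^sup>p mod R\<^sub>y\<close>.
  Division by the monic \<open>R\<^sub>y\<close> shows that the coefficient of \<open>X\<^sup>i\<close> in \<open>h\<^sub>y\<close> is a polynomial in \<open>y\<close>
  of degree at most \<open>p - i\<close>. If \<open>y \<notin> Q\<close>, the roots of \<open>R\<^sub>y\<close> are distinct, so \<open>R\<^sub>y\<close> divides
  \<open>X\<^sup>p - X\<close> and \<open>h\<^sub>y = X\<close>. Hence for \<open>i > |Q|\<close> that coefficient has \<open>p - |Q| > p - i\<close> zeros, so
  \<open>deg h\<^sub>y \<le> |Q|\<close> for all \<open>y\<close>. At \<open>y = -1/\<alpha>\<close> the polynomial \<open>R\<^sub>y\<close> has only \<open>|\<Delta>\<^sub>\<alpha>|\<close> distinct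
  roots, and its repeated part, of degree \<open>|S| - |\<Delta>\<^sub>\<alpha>|\<close>, divides the derivative of
  \<open>X\<^sup>p - h\<^sub>y\<close>, which is \<open>-h\<^sub>y'\<close>. This derivative is nonzero: otherwise \<open>h\<^sub>y\<close> would be constant, and
  all roots of \<open>R\<^sub>y\<close> would coincide, making \<open>S\<close> collinear.
\<close>

section \<open>Fields of prime cardinality\<close>

text \<open>Multiplication by a nonzero \<open>x\<close> permutes the nonzero elements, so their
  product is unchanged by the extra power of \<open>x\<close>.\<close>

lemma power_card_eq_self:
  fixes x :: "'a::field"
  assumes "finite (UNIV :: 'a set)"
  shows "x ^ CARD('a) = x"
proof (cases "x = 0")
  case True
  then show ?thesis using assms by (simp add: finite_UNIV_card_ge_0)
next
  case False
  let ?U = "UNIV - {0 :: 'a}"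
  have fin: "finite ?U" using assms by simp
  have "bij_betw ((*) x) ?U ?U"
    using False by (intro bij_betwI[where g = "\<lambda>y. y / x"]) auto
  then have "(\<Prod>y\<in>?U. x * y) = \<Prod>?U"
    by (rule prod.reindex_bij_betw)
  then have "x ^ card ?U * \<Prod>?U = \<Prod>?U"
    by (simp only: prod.distrib prod_constant)
  moreover have "\<Prod>?U \<noteq> 0" using fin by simp
  ultimately have "x ^ card ?U = 1" by simp
  moreover have "CARD('a) = Suc (card ?U)"
    using card_Suc_Diff1[OF assms UNIV_I, of 0] by simp
  ultimately show ?thesis by (simp only: power_Suc mult_1_right)
qed

text \<open>The translation by 1 permutes the ring, so the sum of all elements absorbs
  \<open>CARD('a)\<close> extra ones.\<close>

lemma of_nat_card_eq_0:
  assumes "finite (UNIV :: 'a::ring_1 set)"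
  shows "of_nat (CARD('a)) = (0 :: 'a)"
proof -
  have "bij_betw (\<lambda>y. y + 1) (UNIV :: 'a set) UNIV"
    by (intro bij_betwI[where g = "\<lambda>y. y - 1"]) auto
  then have "(\<Sum>y\<in>UNIV. y + 1) = (\<Sum>y\<in>UNIV. y :: 'a)"
    by (rule sum.reindex_bij_betw)
  then show ?thesis by (simp add: sum.distrib)
qed

lemma CHAR_eq_card:
  assumes "prime (CARD('a::field))"
  shows "CHAR('a) = CARD('a)"
proof -
  have "finite (UNIV :: 'a set)"
    using assms prime_gt_0_nat card_gt_0_iff by blast
  then have "CHAR('a) dvd CARD('a)"
    using of_nat_card_eq_0 of_nat_eq_0_iff_char_dvd by blast
  then show ?thesis
    using assms CHAR_not_1'[where 'a = 'a] by (metis One_nat_def prime_nat_iff)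
qed

text \<open>Below the characteristic, the factor that differentiation puts on the leading
  coefficient is invertible.\<close>

lemma pderiv_eq_0_imp_degree_eq_0:
  fixes h :: "'a::field poly"
  assumes "pderiv h = 0" "degree h < CHAR('a)"
  shows "degree h = 0"
proof (rule ccontr)
  assume "degree h \<noteq> 0"
  then obtain k where k: "degree h = Suc k" by (cases "degree h") auto
  have "of_nat (Suc k) * coeff h (Suc k) = 0"
    using assms(1) coeff_pderiv[of h k] by simp
  moreover have "coeff h (Suc k) \<noteq> 0"
    using k by (metis degree_0 leading_coeff_0_iff nat.distinct(1))
  ultimately have "of_nat (Suc k) = (0 :: 'a)"
    by (simp del: of_nat_Suc)
  then have "CHAR('a) dvd Suc k"
    by (simp only: of_nat_eq_0_iff_char_dvd)
  then show False using assms(2) k dvd_imp_le by fastforce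
qed

section \<open>Products of linear factors\<close>

lemma degree_prod_linear:
  fixes x :: "'b \<Rightarrow> 'a::idom"
  shows "degree (\<Prod>s\<in>S. [:- x s, 1:]) = card S"
  by (subst degree_prod_eq_sum_degree) auto

lemma lead_coeff_prod_linear:
  fixes x :: "'b \<Rightarrow> 'a::idom"
  shows "lead_coeff (\<Prod>s\<in>S. [:- x s, 1:]) = 1"
  by (simp add: lead_coeff_prod)

lemma prod_linear_dvd:
  fixes P :: "'a::idom poly"
  assumes "finite S" "inj_on x S" "\<And>s. s \<in> S \<Longrightarrow> poly P (x s) = 0"
  shows "(\<Prod>s\<in>S. [:- x s, 1:]) dvd P"
  using assms
proof (induction S rule: finite_induct)
  case empty
  then show ?case by simp
next
  case (insert s S)
  then obtain q where q: "P = (\<Prod>s\<in>S. [:- x s, 1:]) * q"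
    by (auto elim: dvdE)
  \<comment> \<open>By injectivity \<open>x s\<close> differs from the earlier roots, so it must be
    a root of the cofactor \<open>q\<close>.\<close>
  have "poly (\<Prod>s\<in>S. [:- x s, 1:]) (x s) \<noteq> 0"
    using insert by (auto simp: poly_prod inj_on_def)
  moreover have "poly P (x s) = 0" using insert.prems by simp
  ultimately have "[:- x s, 1:] dvd q"
    using q by (simp add: poly_eq_0_iff_dvd)
  then have "[:- x s, 1:] * (\<Prod>s\<in>S. [:- x s, 1:]) dvd P"
    unfolding q by (metis mult.commute mult_dvd_mono dvd_refl)
  then show ?case using insert.hyps by simp
qed

text \<open>A root of multiplicity m has multiplicity m - 1 in \<open>G\<close> and at least m - 1
  in the derivative. The induction adds one factor at a time and moves it into \<open>G\<close>
  exactly when its root has occurred before.\<close>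

lemma prod_linear_repeated_part:
  fixes x :: "'b \<Rightarrow> 'a::idom"
  assumes "finite S"
  obtains G where
    "(\<Prod>s\<in>S. [:- x s, 1:]) = G * (\<Prod>d\<in>x ` S. [:- d, 1:])"
    "G dvd pderiv (\<Prod>s\<in>S. [:- x s, 1:])"
proof -
  have "\<exists>G. (\<Prod>s\<in>S. [:- x s, 1:]) = G * (\<Prod>d\<in>x ` S. [:- d, 1:]) \<and>
      G dvd pderiv (\<Prod>s\<in>S. [:- x s, 1:])"
    using assms
  proof (induction S rule: finite_induct)
    case empty
    then show ?case by (intro exI[of _ 1]) auto
  next
    case (insert s S)
    define R where "R = (\<Prod>s\<in>S. [:- x s, 1:])"
    define D where "D = (\<Prod>d\<in>x ` S. [:- d, 1:])"
    define L where "L = [:- x s, 1:]"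
    obtain G where G: "R = G * D" "G dvd pderiv R"
      using insert.IH unfolding R_def D_def by blast
    have R': "(\<Prod>s\<in>insert s S. [:- x s, 1:]) = L * R"
      using insert.hyps by (simp add: R_def L_def)
    have "pderiv L = 1" by (simp add: L_def pderiv_pCons)
    then have deriv: "pderiv (L * R) = L * pderiv R + R"
      by (simp add: pderiv_mult)
    show ?case
    proof (cases "x s \<in> x ` S")
      case True
      then have "(\<Prod>d\<in>x ` insert s S. [:- d, 1:]) = D"
        by (simp add: D_def insert_absorb)
      moreover have "L dvd D"
        unfolding L_def D_def using True insert.hyps by (intro dvd_prodI) auto
      then have "L * G dvd R"
        unfolding G(1) by (metis mult.commute mult_dvd_mono dvd_refl)
      then have "L * G dvd pderiv (L * R)"
        unfolding deriv using G(2) by (intro dvd_add mult_dvd_mono) auto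
      ultimately show ?thesis
        unfolding R' using G(1) by (intro exI[of _ "L * G"]) (simp add: mult.assoc)
    next
      case False
      then have "(\<Prod>d\<in>x ` insert s S. [:- d, 1:]) = L * D"
        using insert.hyps by (simp add: D_def L_def)
      moreover have "G dvd pderiv (L * R)"
        unfolding deriv using G by (intro dvd_add) auto
      ultimately show ?thesis
        unfolding R' using G(1) by (intro exI[of _ G]) (simp add: mult_ac)
    qed
  qed
  then show ?thesis using that by blast
qed

section \<open>Families of bounded total degree\<close>

text \<open>A family \<open>F\<close> encodes the bivariate polynomial \<open>F(X, y)\<close>, of total degree at most \<open>k\<close>.\<close>

definition total_degree_le :: "nat \<Rightarrow> ('a::comm_ring_1 \<Rightarrow> 'a poly) \<Rightarrow> bool" where
  "total_degree_le k F \<longleftrightarrow>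
    (\<forall>i. \<exists>q. (q = 0 \<or> degree q + i \<le> k) \<and> (\<forall>y. coeff (F y) i = poly q y))"

lemma total_degree_le_const:
  assumes "degree P \<le> k"
  shows "total_degree_le k (\<lambda>_. P)"
  unfolding total_degree_le_def
proof
  fix i
  show "\<exists>q. (q = 0 \<or> degree q + i \<le> k) \<and> (\<forall>y. coeff P i = poly q y)"
    using assms by (intro exI[of _ "[:coeff P i:]"]) (auto intro: order_trans[OF le_degree])
qed

lemma total_degree_le_diff:
  assumes "total_degree_le k F" "total_degree_le k G"
  shows "total_degree_le k (\<lambda>y. F y - G y)"
  unfolding total_degree_le_def
proof
  fix i
  obtain q r where "q = 0 \<or> degree q + i \<le> k" "\<forall>y. coeff (F y) i = poly q y"
    "r = 0 \<or> degree r + i \<le> k" "\<forall>y. coeff (G y) i = poly r y"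
    using assms unfolding total_degree_le_def by meson
  then show "\<exists>q. (q = 0 \<or> degree q + i \<le> k) \<and> (\<forall>y. coeff (F y - G y) i = poly q y)"
    using degree_diff_le_max[of q r] by (intro exI[of _ "q - r"]) auto
qed

lemma total_degree_le_mult:
  fixes F G :: "'a::idom \<Rightarrow> 'a poly"
  assumes "total_degree_le k F" "total_degree_le l G"
  shows "total_degree_le (k + l) (\<lambda>y. F y * G y)"
  unfolding total_degree_le_def
proof
  fix i
  obtain q where q: "\<And>i. q i = 0 \<or> degree (q i) + i \<le> k" "\<And>i y. coeff (F y) i = poly (q i) y"
    using assms(1) unfolding total_degree_le_def by metis
  obtain r where r: "\<And>i. r i = 0 \<or> degree (r i) + i \<le> l" "\<And>i y. coeff (G y) i = poly (r i) y"
    using assms(2) unfolding total_degree_le_def by metis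
  define t where "t = (\<Sum>j\<le>i. q j * r (i - j))"
  have "t = 0 \<or> degree t + i \<le> k + l"
  proof (cases "i \<le> k + l")
    case True
    \<comment> \<open>The bounds add up: (k - j) + (l - (i - j)) = k + l - i.\<close>
    have "degree (q j * r (i - j)) \<le> k + l - i" if "j \<le> i" for j
    proof (cases "q j = 0 \<or> r (i - j) = 0")
      case False
      then have "degree (q j) + j \<le> k" "degree (r (i - j)) + (i - j) \<le> l"
        using q(1) r(1) by blast+
      then show ?thesis
        using False that by (simp add: degree_mult_eq)
    qed auto
    then have "degree t \<le> k + l - i"
      unfolding t_def by (intro degree_sum_le) auto
    then show ?thesis using True by linarith
  next
    case False
    \<comment> \<open>Here j > k or i - j > l, so one of the two factors is zero.\<close>
    have "q j * r (i - j) = 0" if "j \<le> i" for j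
      using q(1)[of j] r(1)[of "i - j"] False that by auto
    then show ?thesis unfolding t_def by (simp add: sum.neutral)
  qed
  moreover have "\<forall>y. coeff (F y * G y) i = poly t y"
    by (simp add: coeff_mult t_def poly_sum q(2) r(2))
  ultimately show "\<exists>q. (q = 0 \<or> degree q + i \<le> k + l) \<and> (\<forall>y. coeff (F y * G y) i = poly q y)"
    by blast
qed

lemma total_degree_le_prod:
  fixes F :: "'b \<Rightarrow> 'a::idom \<Rightarrow> 'a poly"
  assumes "finite S" "\<And>s. s \<in> S \<Longrightarrow> total_degree_le 1 (F s)"
  shows "total_degree_le (card S) (\<lambda>y. \<Prod>s\<in>S. F s y)"
  using assms
proof (induction S rule: finite_induct)
  case empty
  then show ?case by (simp add: total_degree_le_const)
next
  case (insert s S)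
  then show ?case
    using total_degree_le_mult[of 1 "F s" "card S" "\<lambda>y. \<Prod>s\<in>S. F s y"] by simp
qed

lemma total_degree_le_linear:
  fixes a b :: "'a::comm_ring_1"
  shows "total_degree_le 1 (\<lambda>y. [:- (a - y * b), 1:])"
  unfolding total_degree_le_def
proof
  fix i :: nat
  consider "i = 0" | "i = 1" | "i > 1" by linarith
  then show "\<exists>q. (q = 0 \<or> degree q + i \<le> 1) \<and> (\<forall>y. coeff [:- (a - y * b), 1:] i = poly q y)"
  proof cases
    case 1
    then show ?thesis by (intro exI[of _ "[:- a, b:]"]) auto
  next
    case 2
    then show ?thesis by (intro exI[of _ "1"]) auto
  next
    case 3
    then show ?thesis
      by (intro exI[of _ "0"]) (auto simp: coeff_pCons split: nat.split)
  qed
qed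

text \<open>Long division by induction on the degree bound \<open>m\<close>. As \<open>R y\<close>
  is monic, no step divides by a function of \<open>y\<close>, so coefficients stay polynomial in
  \<open>y\<close>.\<close>

lemma total_degree_le_mod:
  fixes F R :: "'a::field \<Rightarrow> 'a poly"
  assumes "total_degree_le k F" "total_degree_le n R"
    and "\<And>y. degree (R y) = n" "\<And>y. lead_coeff (R y) = 1" "n > 0"
    and "\<And>y. degree (F y) < m"
  shows "total_degree_le k (\<lambda>y. F y mod R y)"
  using assms(1,6)
proof (induction m arbitrary: F)
  case 0
  then show ?case by simp
next
  case (Suc m)
  show ?case
  proof (cases "m < n")
    case True
    then have "F y mod R y = F y" for y
      using Suc.prems(2)[of y] assms(3) by (intro mod_poly_less) simp
    then show ?thesis using Suc.prems(1) by simp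
  next
    case False
    \<comment> \<open>The next term of the quotient, chosen to cancel the coefficient of index
      \<open>m\<close>.\<close>
    define M where "M y = monom (coeff (F y) m) (m - n)" for y
    have "total_degree_le k (\<lambda>y. M y * R y)"
    proof -
      obtain q where q: "q = 0 \<or> degree q + m \<le> k" "\<And>y. coeff (F y) m = poly q y"
        using Suc.prems(1) unfolding total_degree_le_def by meson
      show ?thesis
      proof (cases "q = 0")
        case True
        then have "M y = 0" for y using q by (simp add: M_def)
        then show ?thesis by (simp add: total_degree_le_const)
      next
        case q0: False
        \<comment> \<open>This gives k >= m >= n, so the truncated difference \<open>k - n\<close>
          satisfies (k - n) + n = k.\<close>
        then have k: "degree q + m \<le> k" using q by simp
        have "total_degree_le (k - n) M"
          unfolding total_degree_le_def
        proof
          fix i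
          show "\<exists>q. (q = 0 \<or> degree q + i \<le> k - n) \<and> (\<forall>y. coeff (M y) i = poly q y)"
            using k False q(2)
            by (intro exI[of _ "if i = m - n then q else 0"]) (auto simp: M_def)
        qed
        then show ?thesis
          using total_degree_le_mult[OF _ assms(2), of "k - n" M] k False by simp
      qed
    qed
    then have "total_degree_le k (\<lambda>y. F y - M y * R y)"
      using Suc.prems(1) by (intro total_degree_le_diff)
    moreover have "degree (F y - M y * R y) < m" for y
    proof -
      have m: "m > 0" using False assms(5) by simp
      have "degree (M y * R y) \<le> m"
        using degree_mult_le[of "M y" "R y"] degree_monom_le[of "coeff (F y) m" "m - n"] False
        by (simp add: M_def assms(3))
      moreover have "degree (F y) \<le> m" using Suc.prems(2)[of y] by simp
      moreover have "coeff (F y - M y * R y) m = 0"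
        using False assms(3,4)[of y] by (simp add: M_def coeff_monom_mult)
      ultimately show ?thesis
        using m by (intro degree_lessI) (auto simp: coeff_eq_0 le_less)
    qed
    ultimately have "total_degree_le k (\<lambda>y. (F y - M y * R y) mod R y)"
      by (rule Suc.IH)
    moreover have "(F y - M y * R y) mod R y = F y mod R y" for y
      by (metis add_diff_cancel_right' diff_add_cancel mod_mult_self1)
    ultimately show ?thesis by simp
  qed
qed

section \<open>The ratio set and remainders of powers\<close>

text \<open>A coincidence of values with distinct second coordinates would exhibit \<open>y\<close>
  as a ratio.\<close>

lemma inj_on_of_notin_ratio_set:
  assumes "y \<notin> ratio_set S"
  shows "inj_on (\<lambda>s. fst s - y * snd s) S"
proof (rule inj_onI)
  fix s t assume st: "s \<in> S" "t \<in> S" "fst s - y * snd s = fst t - y * snd t"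
  have "snd s = snd t"
  proof (rule ccontr)
    assume ne: "snd s \<noteq> snd t"
    have "fst s - fst t = y * (snd s - snd t)" using st(3) by (simp add: algebra_simps)
    then have "y = (fst s - fst t) / (snd s - snd t)" using ne by simp
    then have "y \<in> ratio_set S"
      unfolding ratio_set_def using st(1,2) ne
      by (intro CollectI exI[of _ "fst s"] exI[of _ "snd s"] exI[of _ "fst t"] exI[of _ "snd t"]) auto
    then show False using assms by simp
  qed
  then show "s = t" using st(3) by (simp add: prod_eq_iff)
qed

lemma not_collinear_obtain:
  assumes "\<not> collinear_pts S"
  obtains a b c d where "(a, b) \<in> S" "(c, d) \<in> S" "b \<noteq> d"
proof -
  from assms obtain a b where ab: "(a, b) \<in> S"
    unfolding collinear_pts_def by fastforce
  from assms have "\<not> (\<forall>(c, d)\<in>S. 0 * c + b - d = 0)"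
    unfolding collinear_pts_def by blast
  then obtain c d where "(c, d) \<in> S" "b \<noteq> d" by auto
  with ab show ?thesis using that by blast
qed

lemma degree_remainder_le_card_ratio_set:
  fixes S :: "('a::field \<times> 'a) set"
  assumes "finite (UNIV :: 'a set)" "ratio_set S \<noteq> {}" "card S \<ge> 2"
  shows "degree (monom 1 CARD('a) mod (\<Prod>s\<in>S. [:- (fst s - y * snd s), 1:]))
    \<le> card (ratio_set S)"
proof -
  define p where "p = CARD('a)"
  define R where "R y = (\<Prod>s\<in>S. [:- (fst s - y * snd s), 1:])" for y
  define h where "h y = monom 1 p mod R y" for y
  have finS: "finite S" using assms(3) by (intro card_ge_0_finite) simp
  have finQ: "finite (ratio_set S)" using assms(1) by (rule finite_subset[rotated]) simp
  have deg: "degree (R y) = card S" for y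
    unfolding R_def by (rule degree_prod_linear)
  have "total_degree_le (card S) R"
    unfolding R_def using finS by (intro total_degree_le_prod total_degree_le_linear)
  moreover have "lead_coeff (R y) = 1" for y
    unfolding R_def by (rule lead_coeff_prod_linear)
  ultimately have td: "total_degree_le p h"
    unfolding h_def using assms(3) deg
    by (intro total_degree_le_mod[where m = "Suc p" and n = "card S"])
       (auto intro!: total_degree_le_const simp: degree_monom_le less_Suc_eq_le)
  have hX: "h y = [:0, 1:]" if "y \<notin> ratio_set S" for y
  proof -
    have "R y dvd monom 1 p - [:0, 1:]"
      unfolding R_def using finS inj_on_of_notin_ratio_set[OF that]
      by (rule prod_linear_dvd) (simp add: poly_monom p_def power_card_eq_self assms(1))
    then have "h y = [:0, 1:] mod R y"
      unfolding h_def by (simp add: mod_eq_dvd_iff)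
    \<comment> \<open>Since \<open>R y\<close> has degree at least 2, X is its own
      remainder.\<close>
    also have "\<dots> = [:0, 1:]"
      using deg assms(3) by (intro mod_poly_less) simp
    finally show ?thesis .
  qed
  have "coeff (h y) i = 0" if i: "i > card (ratio_set S)" for i
  proof -
    obtain q where q: "q = 0 \<or> degree q + i \<le> p" "\<And>y. coeff (h y) i = poly q y"
      using td unfolding total_degree_le_def by meson
    have "card (ratio_set S) > 0" using assms(2) finQ by (simp add: card_gt_0_iff)
    \<comment> \<open>This excludes the index 1, the only nonzero coefficient of X.\<close>
    then have "i > 1" using i by simp
    then have zero: "poly q y = 0" if "y \<notin> ratio_set S" for y
      using hX[OF that] q(2)[of y] by (cases i) (auto simp: coeff_pCons split: nat.splits)
    have "q = 0"
    proof (rule ccontr)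
      assume q0: "q \<noteq> 0"
      \<comment> \<open>\<open>q\<close> vanishes off the ratio set, which is more points than its
        degree \<open>p - i\<close> allows.\<close>
      have "p - card (ratio_set S) = card (- ratio_set S)"
        using assms(1) finQ by (simp add: p_def Compl_eq_Diff_UNIV card_Diff_subset)
      also have "\<dots> \<le> card {y. poly q y = 0}"
        using zero poly_roots_finite[OF q0] by (intro card_mono) auto
      also have "\<dots> \<le> degree q"
        using q0 by (rule card_poly_roots_bound)
      finally show False using q(1) q0 i by simp
    qed
    then show ?thesis using q(2) by simp
  qed
  then show ?thesis
    unfolding h_def R_def p_def by (intro degree_le) auto
qed

theorem theorem6:
  fixes S :: "('a::field \<times> 'a) set" and \<alpha> :: 'a and p n :: nat
  assumes "prime p" and "CARD('a) = p"
    and "card S = n" and "n < p"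
    and "\<alpha> \<noteq> 0"
    and "\<not> collinear_pts S"
  shows "int (card (ratio_set S)) \<ge> int (card S) - int (card (weighted_sumset \<alpha> S)) + 1"
proof -
  have fin: "finite (UNIV :: 'a set)"
    using assms(1,2) prime_gt_0_nat card_gt_0_iff by blast
  then have finS: "finite S"
    by (meson finite_Prod_UNIV finite_subset subset_UNIV)
  have char: "CHAR('a) = p" using CHAR_eq_card assms(1,2) by blast
  obtain a b c d where abcd: "(a, b) \<in> S" "(c, d) \<in> S" "b \<noteq> d"
    using assms(6) by (rule not_collinear_obtain)
  then have Q: "ratio_set S \<noteq> {}" unfolding ratio_set_def by blast
  have "card {(a, b), (c, d)} \<le> card S"
    using abcd finS by (intro card_mono) auto
  then have n2: "card S \<ge> 2" using abcd(3) by simp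
  \<comment> \<open>At this parameter, \<open>\<alpha> * x (a, b) = \<alpha> * a + b\<close>, so the
    distinct roots of \<open>R\<close> correspond to the weighted sumset.\<close>
  define x where "x s = fst s - (- 1 / \<alpha>) * snd s" for s :: "'a \<times> 'a"
  define R where "R = (\<Prod>s\<in>S. [:- x s, 1:])"
  define h where "h = monom 1 p mod R"
  have deg_h: "degree h \<le> card (ratio_set S)"
    unfolding h_def R_def x_def assms(2)[symmetric]
    by (rule degree_remainder_le_card_ratio_set[OF fin Q n2])
  have degR: "degree R = card S" unfolding R_def by (rule degree_prod_linear)
  have "\<alpha> * x (a, b) = \<alpha> * a + b" for a b
    using assms(5) by (simp add: x_def algebra_simps)
  then have "(\<lambda>s. \<alpha> * x s) = (\<lambda>(a, b). \<alpha> * a + b)"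
    by (simp add: fun_eq_iff)
  moreover have "weighted_sumset \<alpha> S = (\<lambda>(a, b). \<alpha> * a + b) ` S"
    unfolding weighted_sumset_def by force
  ultimately have "weighted_sumset \<alpha> S = (*) \<alpha> ` x ` S"
    by (simp only: image_image)
  then have card_x: "card (x ` S) = card (weighted_sumset \<alpha> S)"
    using assms(5) by (simp add: card_image inj_on_def)
  have R_dvd: "R dvd monom 1 p - h"
    unfolding h_def by (simp add: dvd_minus_mod)
  obtain G where G: "R = G * (\<Prod>d\<in>x ` S. [:- d, 1:])" "G dvd pderiv R"
    unfolding R_def using finS by (rule prod_linear_repeated_part)
  have R0: "R \<noteq> 0" using degR n2 by auto
  have "degree R = degree G + degree (\<Prod>d\<in>x ` S. [:- d, 1:])"
    using R0 unfolding G(1) by (intro degree_mult_eq) auto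
  then have degG: "card S = degree G + card (x ` S)"
    using degR degree_prod_linear[of "\<lambda>d. d" "x ` S"] by simp
  obtain f where "monom 1 p - h = R * f" using R_dvd by (rule dvdE)
  then have "pderiv (monom 1 p - h) = R * pderiv f + f * pderiv R"
    by (simp add: pderiv_mult)
  moreover have "G dvd R * pderiv f + f * pderiv R"
    using G by (intro dvd_add) auto
  \<comment> \<open>The derivative of X^p vanishes because \<open>p\<close> is the
    characteristic.\<close>
  moreover have "pderiv (monom 1 p - h) = - pderiv h"
    by (simp add: pderiv_diff pderiv_monom flip: char)
  ultimately have G_dvd: "G dvd pderiv h"
    by (metis dvd_minus_iff)
  have "pderiv h \<noteq> 0"
  proof
    assume "pderiv h = 0"
    moreover have "degree h < CHAR('a)"
    proof -
      have "degree h < degree R"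
        unfolding h_def using degree_mod_less[OF R0, of "monom 1 p"] degR n2 by auto
      then show ?thesis using degR assms(3,4) char by simp
    qed
    ultimately have "degree h = 0" by (rule pderiv_eq_0_imp_degree_eq_0)
    then obtain e where e: "h = [:e:]" by (rule degree_eq_zeroE)
    \<comment> \<open>Each root of \<open>R\<close> satisfies x^p = e, and x^p = x in the
      field.\<close>
    have "x s = e" if "s \<in> S" for s
    proof -
      have "[:- x s, 1:] dvd R"
        unfolding R_def using that finS by (intro dvd_prodI) auto
      then have "poly (monom 1 p - h) (x s) = 0"
        using R_dvd poly_eq_0_iff_dvd dvd_trans by blast
      then show ?thesis
        using power_card_eq_self[OF fin, of "x s"] assms(2) by (simp add: e poly_monom)
    qed
    \<comment> \<open>All points then lie on the line of slope \<open>- \<alpha>\<close> and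
      intercept \<open>\<alpha> * e\<close>.\<close>
    moreover have "(- \<alpha>) * a + \<alpha> * x (a, b) - b = 0" for a b
      using assms(5) by (simp add: x_def algebra_simps)
    ultimately have "\<forall>(a, b)\<in>S. (- \<alpha>) * a + \<alpha> * e - b = 0"
      by fastforce
    then show False using assms(6) unfolding collinear_pts_def by blast
  qed
  then have "degree G \<le> degree (pderiv h)" "degree h \<noteq> 0"
    using dvd_imp_degree_le[OF G_dvd] degree_eq_zeroE[of h] pderiv_singleton by metis+
  \<comment> \<open>The degree lost by differentiation supplies the \<open>+ 1\<close>;
    \<open>degree h\<close> being nonzero makes the truncated \<open>degree h - 1\<close> a true
    predecessor.\<close>
  moreover have "degree (pderiv h) \<le> degree h - 1"
    by (intro degree_le) (auto simp: coeff_pderiv coeff_eq_0)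
  ultimately show ?thesis using degG deg_h card_x by simp
qed

end
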